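(* Let $T:X\to X$ be a non-singular measurable transformation and $u:X\to\mathbb C$ a measurable function, not a.e. zero, such that $W_{u,T}$ is a bounded operator on $L(p,q)$. Suppose $u\in L_\infty(\mu)$ and $h_T=0$ a.e. on $(\mathrm{Supp}(u))^c$. Then, for a non-negative integer $k$, $\alpha(W_{u,T})=k$ if and only if $k$ is the least non-negative integer such that $\mu_k$ and $\mu_{k+1}$ are equivalent measures.
   Context: $(X,\mathcal A,\mu)$ is a $\sigma$-finite complete measure space. For measurable $h:X\to\mathbb C$ put $\mu_h(s)=\mu(\{x\in X:|h(x)|>s\})$ for $s\ge 0$, $h^*(t)=\inf\{s>0:\mu_h(s)\le t\}$ and $h^{**}(t)=\frac1t\int_0^t h^*(s)\,ds$ for $t>0$. The Lorentz space $L(p,q)$ (for $1<p<\infty$, $1\le q<\infty$, or $1<p\le\infty$, $q=\infty$) is the Banach space of (a.e.-equivalence classes of) measurable $h:X\to\mathbb C$ with $\|h\|_{pq}<\infty$, where $\|h\|_{pq}=\left(\frac qp\int_0^\infty (t^{1/p}h^{**}(t))^q\frac{dt}{t}\right)^{1/q}$ if $1<p<\infty$, $1\le q<\infty$, and $\|h\|_{pq}=\sup_{t>0}t^{1/p}h^{**}(t)$ if $1<p\le\infty$, $q=\infty$. A measurable transformation $T:X\to X$ is non-singular if $\mu(A)=0$ implies $\mu(T^{-1}(A))=0$. For $k\ge 0$, $\mu_k(A)=\mu(T^{-k}(A))$ (so $\mu_0=\mu$), and $h_{T^k}\ge 0$ is the (locally integrable) Radon–Nikodym derivative: $\mu_k(A)=\int_A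 h_{T^k}\,d\mu$ for $A\in\mathcal A$. Here $\mathrm{Supp}(u)=\{x:u(x)\ne 0\}$ and $(\mathrm{Supp}(u))^c$ is its complement. $W_{u,T}f=(u\circ T)\cdot(f\circ T)$. Two measures $\mu,\nu$ are equivalent if $\mu\ll\nu$ and $\nu\ll\mu$. For a bounded operator $L$ with null space $\mathcal N(L)$, the ascent is $\alpha(L)=\inf\{k\in\mathbb N\cup\{0\}:\mathcal N(L^{k+1})=\mathcal N(L^k)\}$ (equal to $\infty$ if no such $k$ exists). *)

theory Defs
  imports "HOL-Analysis.Analysis"
begin

section \<open>Lorentz spaces\<close>

definition distribution_fun :: "'a measure \<Rightarrow> ('a \<Rightarrow> complex) \<Rightarrow> real \<Rightarrow> ennreal" where
  "distribution_fun M h s = emeasure M {x \<in> space M. norm (h x) > s}"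

text \<open>The infimum is taken in \<^typ>\<open>ennreal\<close>, so that it is \<^term>\<open>\<infinity>\<close> for the empty set.\<close>

definition rearrangement :: "'a measure \<Rightarrow> ('a \<Rightarrow> complex) \<Rightarrow> real \<Rightarrow> ennreal" where
  "rearrangement M h t = Inf (ennreal ` {s. 0 < s \<and> distribution_fun M h s \<le> ennreal t})"

definition average_rearrangement :: "'a measure \<Rightarrow> ('a \<Rightarrow> complex) \<Rightarrow> real \<Rightarrow> ennreal" where
  "average_rearrangement M h t =
     (\<integral>\<^sup>+ s \<in> {0<..<t}. rearrangement M h s \<partial>lborel) / ennreal t"

text \<open>Power with a positive real exponent; there is no \<^const>\<open>powr\<close> on \<^typ>\<open>ennreal\<close>.\<close>

definition ennreal_rpow :: "ennreal \<Rightarrow> real \<Rightarrow> ennreal" where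
  "ennreal_rpow x a = (if x = \<infinity> then \<infinity> else ennreal (enn2real x powr a))"

definition lorentz_exponents :: "ennreal \<Rightarrow> ennreal \<Rightarrow> bool" where
  "lorentz_exponents p q \<longleftrightarrow> (1 < p \<and> p < \<infinity> \<and> 1 \<le> q \<and> q < \<infinity>) \<or> (1 < p \<and> q = \<infinity>)"

text \<open>The exponent \<open>1/p\<close> is \<^term>\<open>enn2real (1 / p)\<close>, which is \<open>0\<close> for \<open>p = \<infinity>\<close>.\<close>

definition lorentz_norm :: "'a measure \<Rightarrow> ennreal \<Rightarrow> ennreal \<Rightarrow> ('a \<Rightarrow> complex) \<Rightarrow> ennreal" where
  "lorentz_norm M p q h =
     (if q = \<infinity> then
        (SUP t \<in> {0<..}. ennreal (t powr enn2real (1 / p)) * average_rearrangement M h t)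
      else
        ennreal_rpow
          (q / p * (\<integral>\<^sup>+ t \<in> {0<..}.
             ennreal_rpow (ennreal (t powr enn2real (1 / p)) * average_rearrangement M h t)
               (enn2real q) / ennreal t \<partial>lborel))
          (1 / enn2real q))"

definition lorentz_functions :: "'a measure \<Rightarrow> ennreal \<Rightarrow> ennreal \<Rightarrow> ('a \<Rightarrow> complex) set" where
  "lorentz_functions M p q = {h \<in> borel_measurable M. lorentz_norm M p q h < \<infinity>}"

definition ae_rel :: "'a measure \<Rightarrow> (('a \<Rightarrow> complex) \<times> ('a \<Rightarrow> complex)) set" where
  "ae_rel M = {(f, g). f \<in> borel_measurable M \<and> g \<in> borel_measurable M \<and> (AE x in M. f x = g x)}"

definition ae_class :: "'a measure \<Rightarrow> ('a \<Rightarrow> complex) \<Rightarrow> ('a \<Rightarrow> complex) set" where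
  "ae_class M f = ae_rel M `` {f}"

definition lorentz_space :: "'a measure \<Rightarrow> ennreal \<Rightarrow> ennreal \<Rightarrow> ('a \<Rightarrow> complex) set set" where
  "lorentz_space M p q = lorentz_functions M p q // ae_rel M"

definition lorentz_class_norm ::
    "'a measure \<Rightarrow> ennreal \<Rightarrow> ennreal \<Rightarrow> ('a \<Rightarrow> complex) set \<Rightarrow> ennreal" where
  "lorentz_class_norm M p q F = the_elem (lorentz_norm M p q ` F)"

lemma equiv_ae_rel: "equiv (borel_measurable M) (ae_rel M)"
proof (rule equivI)
  show "ae_rel M \<subseteq> borel_measurable M \<times> borel_measurable M"
    by (auto simp: ae_rel_def)
  show "refl_on (borel_measurable M) (ae_rel M)"
    by (rule refl_onI) (simp add: ae_rel_def)
  show "sym (ae_rel M)"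
    by (rule symI) (auto simp: ae_rel_def)
  show "trans (ae_rel M)"
  proof (rule transI)
    fix f g h
    assume "(f, g) \<in> ae_rel M" and "(g, h) \<in> ae_rel M"
    then have "AE x in M. f x = g x" and "AE x in M. g x = h x"
      by (simp_all add: ae_rel_def)
    then have "AE x in M. f x = h x"
      by eventually_elim simp
    then show "(f, h) \<in> ae_rel M"
      using \<open>(f, g) \<in> ae_rel M\<close> \<open>(g, h) \<in> ae_rel M\<close> by (simp add: ae_rel_def)
  qed
qed

lemma lorentz_norm_cong_AE:
  assumes [measurable]: "f \<in> borel_measurable M" "g \<in> borel_measurable M"
    and "AE x in M. f x = g x"
  shows "lorentz_norm M p q f = lorentz_norm M p q g"
proof -
  have "distribution_fun M f s = distribution_fun M g s" for s
    unfolding distribution_fun_def using assms(3) by (intro emeasure_eq_AE) auto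
  then show ?thesis
    by (simp add: lorentz_norm_def average_rearrangement_def rearrangement_def)
qed

lemma lorentz_class_norm_ae_class:
  assumes "f \<in> borel_measurable M"
  shows "lorentz_class_norm M p q (ae_class M f) = lorentz_norm M p q f"
proof -
  have "f \<in> ae_class M f"
    using assms by (simp add: ae_class_def ae_rel_def)
  moreover have "lorentz_norm M p q f = lorentz_norm M p q g" if "g \<in> ae_class M f" for g
    using that by (intro lorentz_norm_cong_AE) (simp_all add: ae_class_def ae_rel_def)
  ultimately have "lorentz_norm M p q ` ae_class M f = {lorentz_norm M p q f}"
    using image_constant[of f "ae_class M f" "lorentz_norm M p q f"]
    by (metis (no_types, lifting) image_cong)
  then show ?thesis
    by (simp add: lorentz_class_norm_def)
qed

section \<open>Operators on Lorentz spaces\<close>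

text \<open>Linearity is not part of this predicate: it is only applied to the weighted composition
  operators below, which are linear.\<close>

definition bounded_on_lorentz ::
    "'a measure \<Rightarrow> ennreal \<Rightarrow> ennreal \<Rightarrow> (('a \<Rightarrow> complex) set \<Rightarrow> ('a \<Rightarrow> complex) set) \<Rightarrow> bool" where
  "bounded_on_lorentz M p q L \<longleftrightarrow>
     L \<in> lorentz_space M p q \<rightarrow> lorentz_space M p q \<and>
     (\<exists>C::real. \<forall>F \<in> lorentz_space M p q.
        lorentz_class_norm M p q (L F) \<le> ennreal C * lorentz_class_norm M p q F)"

definition lorentz_null_space ::
    "'a measure \<Rightarrow> ennreal \<Rightarrow> ennreal \<Rightarrow> (('a \<Rightarrow> complex) set \<Rightarrow> ('a \<Rightarrow> complex) set)
      \<Rightarrow> ('a \<Rightarrow> complex) set set" where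
  "lorentz_null_space M p q L = {F \<in> lorentz_space M p q. L F = ae_class M (\<lambda>_. 0)}"

definition ascent ::
    "'a measure \<Rightarrow> ennreal \<Rightarrow> ennreal \<Rightarrow> (('a \<Rightarrow> complex) set \<Rightarrow> ('a \<Rightarrow> complex) set) \<Rightarrow> enat" where
  "ascent M p q L =
     Inf (enat ` {k. lorentz_null_space M p q (L ^^ (k + 1)) = lorentz_null_space M p q (L ^^ k)})"

section \<open>Non-singular transformations and weighted composition operators\<close>

definition nonsingular :: "'a measure \<Rightarrow> ('a \<Rightarrow> 'a) \<Rightarrow> bool" where
  "nonsingular M T \<longleftrightarrow> T \<in> measurable M M \<and>
     (\<forall>A \<in> sets M. emeasure M A = 0 \<longrightarrow> emeasure M (T -` A \<inter> space M) = 0)"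

definition pushforward_measure :: "'a measure \<Rightarrow> ('a \<Rightarrow> 'a) \<Rightarrow> nat \<Rightarrow> 'a measure" where
  "pushforward_measure M T k = distr M M (T ^^ k)"

definition pushforward_deriv :: "'a measure \<Rightarrow> ('a \<Rightarrow> 'a) \<Rightarrow> nat \<Rightarrow> 'a \<Rightarrow> ennreal" where
  "pushforward_deriv M T k = RN_deriv M (pushforward_measure M T k)"

definition equivalent_measures :: "'a measure \<Rightarrow> 'a measure \<Rightarrow> bool" where
  "equivalent_measures M N \<longleftrightarrow> absolutely_continuous M N \<and> absolutely_continuous N M"

definition Supp :: "'a measure \<Rightarrow> ('a \<Rightarrow> complex) \<Rightarrow> 'a set" where
  "Supp M u = {x \<in> space M. u x \<noteq> 0}"

definition essentially_bounded :: "'a measure \<Rightarrow> ('a \<Rightarrow> complex) \<Rightarrow> bool" where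
  "essentially_bounded M u \<longleftrightarrow> u \<in> borel_measurable M \<and> (\<exists>C::real. AE x in M. norm (u x) \<le> C)"

definition weighted_composition ::
    "'a measure \<Rightarrow> ('a \<Rightarrow> complex) \<Rightarrow> ('a \<Rightarrow> 'a) \<Rightarrow> ('a \<Rightarrow> complex) set \<Rightarrow> ('a \<Rightarrow> complex) set" where
  "weighted_composition M u T F = (\<Union>f \<in> F. ae_class M (\<lambda>x. u (T x) * f (T x)))"

lemma emeasure_pushforward_measure:
  assumes "T \<in> measurable M M" and "A \<in> sets M"
  shows "emeasure (pushforward_measure M T k) A = emeasure M ((T ^^ k) -` A \<inter> space M)"
proof -
  have "T ^^ k \<in> measurable M M"
  proof (induction k)
    case 0
    show ?case by simp
  next
    case (Suc k)
    then show ?case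
      using measurable_comp[OF Suc assms(1)] by (simp add: o_def)
  qed
  then show ?thesis
    using assms(2) by (simp add: pushforward_measure_def emeasure_distr)
qed

lemma nonsingular_AE:
  assumes "nonsingular M T" and "AE x in M. P x"
  shows "AE x in M. P (T x)"
proof -
  obtain N where N: "N \<in> sets M" "emeasure M N = 0" "{x \<in> space M. \<not> P x} \<subseteq> N"
    using assms(2) by (auto elim: AE_E)
  have T: "T \<in> measurable M M" and null: "emeasure M (T -` N \<inter> space M) = 0"
    using assms(1) N by (auto simp: nonsingular_def)
  have "{x \<in> space M. \<not> P (T x)} \<subseteq> T -` N \<inter> space M"
    using N(3) measurable_space[OF T] by auto
  then show ?thesis
    using null measurable_sets[OF T N(1)] by (intro AE_I[where N = "T -` N \<inter> space M"])
qed

lemma weighted_composition_ae_class: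
  assumes "nonsingular M T" and [measurable]: "u \<in> borel_measurable M" "f \<in> borel_measurable M"
  shows "weighted_composition M u T (ae_class M f) = ae_class M (\<lambda>x. u (T x) * f (T x))"
proof -
  have [measurable]: "T \<in> measurable M M"
    using assms(1) by (simp add: nonsingular_def)
  have "ae_class M (\<lambda>x. u (T x) * g (T x)) = ae_class M (\<lambda>x. u (T x) * f (T x))"
    if "g \<in> ae_class M f" for g
  proof -
    have [measurable]: "g \<in> borel_measurable M" and fg: "AE x in M. f x = g x"
      using that by (simp_all add: ae_class_def ae_rel_def)
    have "AE x in M. f (T x) = g (T x)"
      using nonsingular_AE[OF assms(1) fg] .
    then have "AE x in M. u (T x) * g (T x) = u (T x) * f (T x)"
      by eventually_elim simp
    then have "((\<lambda>x. u (T x) * g (T x)), (\<lambda>x. u (T x) * f (T x))) \<in> ae_rel M"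
      by (simp add: ae_rel_def)
    then show ?thesis
      unfolding ae_class_def by (rule equiv_class_eq[OF equiv_ae_rel])
  qed
  moreover have "f \<in> ae_class M f"
    by (simp add: ae_class_def ae_rel_def)
  ultimately show ?thesis
    unfolding weighted_composition_def by blast
qed

end

theory Submission
  imports Defs
begin

text \<open>Off the support of \<open>u\<close> the derivative of \<open>\<mu>\<^sub>1\<close> vanishes, so \<open>u \<circ> T \<noteq> 0\<close> almost everywhere, and
  by non-singularity the same holds for the weight \<open>\<Prod>\<^sub>j u \<circ> T\<^sup>j\<close> of \<open>W\<^sup>k\<close>. Hence \<open>W\<^sup>k f = 0\<close> iff
  \<open>f \<circ> T\<^sup>k = 0\<close> a.e., that is, iff \<open>\<mu>\<^sub>k\<close> does not charge the support of \<open>f\<close>. Since indicators of sets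
  of finite measure lie in the Lorentz space and \<open>M\<close> is \<open>\<sigma>\<close>-finite, the null spaces of \<open>W\<^sup>k\<close> and
  \<open>W\<^sup>k\<^sup>+\<^sup>1\<close> agree iff \<open>\<mu>\<^sub>k\<close> and \<open>\<mu>\<^sub>k\<^sub>+\<^sub>1\<close> have the same null sets.\<close>

section \<open>Lorentz norms of indicators of sets of finite measure\<close>

lemma ennreal_rpow_mono:
  assumes "x \<le> y" "0 \<le> a"
  shows "ennreal_rpow x a \<le> ennreal_rpow y a"
proof (cases "y = \<infinity>")
  case False
  then have "y < \<infinity>" by (simp add: less_top)
  with assms have "x \<noteq> \<infinity>" and "enn2real x \<le> enn2real y"
    by (auto intro: enn2real_mono)
  with False assms(2) show ?thesis
    by (auto simp: ennreal_rpow_def intro!: ennreal_leI powr_mono2)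
qed (simp add: ennreal_rpow_def)

lemma ennreal_rpow_ennreal: "0 \<le> x \<Longrightarrow> ennreal_rpow (ennreal x) a = ennreal (x powr a)"
  by (simp add: ennreal_rpow_def)

lemma mult_right_mono_indicator:
  fixes x y :: ennreal
  assumes "t \<in> A \<Longrightarrow> x \<le> y"
  shows "x * indicator A t \<le> y * indicator A t"
  using assms by (simp split: split_indicator)

lemma rearrangement_indicator_le:
  "rearrangement M (indicator A) t \<le> 1"
proof -
  have "distribution_fun M (indicator A) 1 = 0"
    by (auto simp: distribution_fun_def indicator_def)
  then show ?thesis
    unfolding rearrangement_def by (intro Inf_lower2[of "ennreal 1"]) auto
qed

text \<open>The set where the indicator exceeds a level \<open>e > 0\<close> lies in
  \<open>A\<close>, so every positive level is admissible in the infimum once \<open>t\<close>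
  reaches the measure of \<open>A\<close>.\<close>

lemma rearrangement_indicator_eq_0:
  assumes A: "A \<in> sets M" and t: "emeasure M A \<le> ennreal t"
  shows "rearrangement M (indicator A) t = 0"
proof -
  have "rearrangement M (indicator A) t \<le> 0 + ennreal e" if "0 < e" for e :: real
  proof -
    have "distribution_fun M (indicator A) e \<le> emeasure M A"
      unfolding distribution_fun_def using A that
      by (intro emeasure_mono) (auto simp: indicator_def split: if_splits)
    then show ?thesis
      unfolding rearrangement_def using that t by (intro Inf_lower) auto
  qed
  then have "rearrangement M (indicator A) t \<le> 0"
    by (rule ennreal_le_epsilon)
  then show ?thesis by simp
qed

lemma average_rearrangement_indicator_le_1:
  assumes "0 < t"
  shows "average_rearrangement M (indicator A) t \<le> 1"
proof -
  have "(\<integral>\<^sup>+ s \<in> {0<..<t}. rearrangement M (indicator A) s \<partial>lborel)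
      \<le> (\<integral>\<^sup>+ s. indicator {0<..<t} s \<partial>lborel)"
    by (intro nn_integral_mono) (auto simp: indicator_def rearrangement_indicator_le)
  also have "\<dots> = ennreal t"
    using assms by simp
  finally have "average_rearrangement M (indicator A) t \<le> ennreal t / ennreal t"
    unfolding average_rearrangement_def by (rule divide_right_mono_ennreal)
  then show ?thesis
    using assms by (simp add: divide_ennreal)
qed

text \<open>The rearrangement is at most 1 and vanishes from \<open>m\<close> on, so its integral
  over any initial interval is at most \<open>m\<close>. This gives the decay for large
  \<open>t\<close> that the constant bound 1 lacks.\<close>

lemma average_rearrangement_indicator_le:
  assumes "A \<in> sets M" "emeasure M A = ennreal m" "0 \<le> m" "0 < t"
  shows "average_rearrangement M (indicator A) t \<le> ennreal (m / t)"
proof -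
  have "(\<integral>\<^sup>+ s \<in> {0<..<t}. rearrangement M (indicator A) s \<partial>lborel)
      \<le> (\<integral>\<^sup>+ s. indicator {0<..<m} s \<partial>lborel)"
  proof (intro nn_integral_mono)
    fix s :: real
    show "rearrangement M (indicator A) s * indicator {0<..<t} s \<le> indicator {0<..<m} s"
      using rearrangement_indicator_eq_0[OF assms(1), of s] assms(2,3)
      by (cases "s < m") (auto simp: indicator_def rearrangement_indicator_le ennreal_leI)
  qed
  also have "\<dots> = ennreal m"
    using assms by simp
  finally have "average_rearrangement M (indicator A) t \<le> ennreal m / ennreal t"
    unfolding average_rearrangement_def by (rule divide_right_mono_ennreal)
  then show ?thesis
    using assms by (simp add: divide_ennreal)
qed

text \<open>The bound 1 is the useful one near 0 and \<open>m / t\<close> near infinity; switching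
  at \<open>t = 1\<close> gives a majorant made of two pure powers.\<close>

lemma indicator_weighted_average_bound:
  assumes A: "A \<in> sets M" "emeasure M A = ennreal m" "0 \<le> m" and t: "0 < t"
  shows "ennreal (t powr a) * average_rearrangement M (indicator A) t
    \<le> ennreal (if t \<le> 1 then t powr a else m * t powr (a - 1))"
proof (cases "t \<le> 1")
  case True
  then show ?thesis
    using mult_left_mono[OF average_rearrangement_indicator_le_1[OF t], of "ennreal (t powr a)" M A]
    by simp
next
  case False
  have "ennreal (t powr a) * average_rearrangement M (indicator A) t
      \<le> ennreal (t powr a) * ennreal (m / t)"
    by (intro mult_left_mono average_rearrangement_indicator_le A t) simp
  also have "\<dots> = ennreal (m * t powr (a - 1))"
    using t A by (simp add: ennreal_mult'[symmetric] powr_diff)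
  finally show ?thesis using False by simp
qed

lemma nn_integral_powr_split_finite:
  fixes C :: real
  assumes "- 1 < b" "c < - 1" "0 \<le> C"
  shows "(\<integral>\<^sup>+ t \<in> {0<..}. ennreal (if t \<le> 1 then t powr b else C * t powr c) \<partial>lborel) < \<infinity>"
proof -
  have ind: "indicator X t * ennreal y = ennreal (indicator X t * y)" for X and t y :: real
    by (simp split: split_indicator)
  have 1: "(\<integral>\<^sup>+ t. indicator {0..1} t * ennreal (t powr b) \<partial>lborel) < \<infinity>"
    using nn_integral_has_integral_lebesgue[OF _ has_integral_powr_from_0[OF assms(1), of 1]]
    unfolding ind by simp
  have 2: "(\<integral>\<^sup>+ t. indicator {1..} t * ennreal (t powr c) \<partial>lborel) < \<infinity>"
    using nn_integral_has_integral_lebesgue[OF _ has_integral_powr_to_inf[OF assms(2), of 1]]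
    unfolding ind by simp
  \<comment> \<open>The two ranges share the point 1, which is harmless for an upper bound.\<close>
  have "(\<integral>\<^sup>+ t \<in> {0<..}. ennreal (if t \<le> 1 then t powr b else C * t powr c) \<partial>lborel)
     \<le> (\<integral>\<^sup>+ t. indicator {0..1} t * ennreal (t powr b)
          + ennreal C * (indicator {1..} t * ennreal (t powr c)) \<partial>lborel)"
    using assms(3) by (intro nn_integral_mono) (auto simp: indicator_def ennreal_mult)
  also have "\<dots> = (\<integral>\<^sup>+ t. indicator {0..1} t * ennreal (t powr b) \<partial>lborel)
          + ennreal C * (\<integral>\<^sup>+ t. indicator {1..} t * ennreal (t powr c) \<partial>lborel)"
    by (simp add: nn_integral_add nn_integral_cmult)
  also have "\<dots> < \<infinity>"
    using 1 2 by (simp add: ennreal_mult_less_top)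
  finally show ?thesis .
qed

text \<open>This supplies the test functions for comparing null spaces. With \<open>a = 1/p\<close>,
  the condition \<open>1 < p\<close> gives \<open>a < 1\<close>, hence control at infinity. At 0,
  \<open>0 \<le> a\<close> suffices for the supremum norm, including \<open>p = \<infinity>\<close>
  where \<open>a = 0\<close>; the integral norm needs \<open>0 < a\<close>, available since
  \<open>p\<close> is then finite.\<close>

lemma lorentz_norm_indicator_finite:
  assumes pq: "lorentz_exponents p q" and A: "A \<in> sets M" "emeasure M A < \<infinity>"
  shows "lorentz_norm M p q (indicator A) < \<infinity>"
proof -
  obtain m where m: "0 \<le> m" "emeasure M A = ennreal m"
    using A(2) by (cases "emeasure M A") auto
  define a where "a = enn2real (1 / p)"
  have p1: "1 < p" using pq by (auto simp: lorentz_exponents_def)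
  have "a < 1" "0 \<le> a" "p < \<infinity> \<Longrightarrow> 0 < a"
  proof -
    have "1 / p < 1"
    proof (cases p)
      case (real s)
      then have "1 < s"
        using p1 by (simp add: ennreal_less_iff flip: ennreal_1)
      then show ?thesis
        using real by (simp add: divide_ennreal ennreal_less_iff flip: ennreal_1)
    qed simp
    then show "a < 1"
      unfolding a_def using enn2real_less_iff[of "1 / p" 1] by (cases "1 / p") auto
    show "0 < a" if "p < \<infinity>"
      unfolding a_def using that \<open>1 / p < 1\<close>
      by (auto simp: enn2real_positive_iff ennreal_zero_less_divide intro: less_trans)
  qed (simp add: a_def)
  show ?thesis
  proof (cases "q = \<infinity>")
    case True
    have "ennreal (t powr a) * average_rearrangement M (indicator A) t \<le> ennreal (max 1 m)"
      if t: "0 < t" for t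
    proof -
      have "m * t powr (a - 1) \<le> m" if "1 < t"
        using that m \<open>a < 1\<close> powr_mono[of "a - 1" 0 t] mult_left_mono[of "t powr (a-1)" 1 m]
        by simp
      moreover have "t powr a \<le> 1" if "t \<le> 1"
        using that t \<open>0 \<le> a\<close> by (simp add: powr_le1)
      ultimately have "(if t \<le> 1 then t powr a else m * t powr (a - 1)) \<le> max 1 m"
        by auto
      then show ?thesis
        using indicator_weighted_average_bound[OF A(1) m(2,1) t, of a] ennreal_leI order_trans
        by blast
    qed
    then have "lorentz_norm M p q (indicator A) \<le> ennreal (max 1 m)"
      unfolding lorentz_norm_def using True by (auto intro!: SUP_least simp: a_def)
    also have "\<dots> < \<infinity>" by simp
    finally show ?thesis .
  next
    case False
    define r where "r = enn2real q"
    have fin: "p < \<infinity>" "1 \<le> q" "q < \<infinity>"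
      using pq False by (auto simp: lorentz_exponents_def)
    have r: "1 \<le> r"
      using fin enn2real_mono[of 1 q] by (simp add: r_def)
    \<comment> \<open>The two-power majorant raised to the power \<open>r\<close>, with the factor
      \<open>1 / t\<close> absorbed into the exponents.\<close>
    let ?g = "\<lambda>t. if t \<le> 1 then t powr (a * r - 1) else m powr r * t powr ((a - 1) * r - 1)"
    have "ennreal_rpow (ennreal (t powr a) * average_rearrangement M (indicator A) t) r / ennreal t
        \<le> ennreal (?g t)" if t: "0 < t" for t
    proof -
      have "ennreal_rpow (ennreal (t powr a) * average_rearrangement M (indicator A) t) r
          \<le> ennreal ((if t \<le> 1 then t powr a else m * t powr (a - 1)) powr r)"
        using ennreal_rpow_mono[OF indicator_weighted_average_bound[OF A(1) m(2,1) t, of a], of r]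
          r m(1) by (simp add: ennreal_rpow_ennreal del: if_distrib)
      then have "ennreal_rpow (ennreal (t powr a) * average_rearrangement M (indicator A) t) r
            / ennreal t
          \<le> ennreal ((if t \<le> 1 then t powr a else m * t powr (a - 1)) powr r) / ennreal t"
        by (rule divide_right_mono_ennreal)
      also have "\<dots> = ennreal (?g t)"
        using t m(1)
        by (simp add: divide_ennreal powr_powr powr_mult powr_diff[of t "a * r" 1]
            powr_diff[of t "(a - 1) * r" 1])
      finally show ?thesis .
    qed
    then have "(\<integral>\<^sup>+ t \<in> {0<..}. ennreal_rpow (ennreal (t powr a) *
          average_rearrangement M (indicator A) t) r / ennreal t \<partial>lborel)
        \<le> (\<integral>\<^sup>+ t \<in> {0<..}. ennreal (?g t) \<partial>lborel)"
      by (intro nn_integral_mono mult_right_mono_indicator) simp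
    \<comment> \<open>Since \<open>0 < a < 1\<close> and \<open>1 \<le> r\<close>, the exponent
      \<open>a * r - 1\<close> exceeds -1 and \<open>(a - 1) * r - 1\<close> is below -1.\<close>
    also have "\<dots> < \<infinity>"
      using \<open>a < 1\<close> \<open>p < \<infinity> \<Longrightarrow> 0 < a\<close> fin r m(1)
      by (intro nn_integral_powr_split_finite) (auto simp: mult_neg_pos)
    finally have I: "(\<integral>\<^sup>+ t \<in> {0<..}. ennreal_rpow (ennreal (t powr a) *
          average_rearrangement M (indicator A) t) r / ennreal t \<partial>lborel) < \<infinity>" .
    have "q / p < \<infinity>"
      using p1 fin by (auto simp: ennreal_divide_eq_top_iff less_top[symmetric])
    with I show ?thesis
      using False unfolding lorentz_norm_def a_def[symmetric] r_def[symmetric]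
      by (auto simp: ennreal_rpow_def ennreal_mult_less_top less_top[symmetric] ennreal_mult_eq_top_iff)
  qed
qed

section \<open>Iterates of the weighted composition operator and their kernels\<close>

lemma ae_class_eq_iff:
  assumes "f \<in> borel_measurable M" "g \<in> borel_measurable M"
  shows "ae_class M f = ae_class M g \<longleftrightarrow> (AE x in M. f x = g x)"
  unfolding ae_class_def eq_equiv_class_iff[OF equiv_ae_rel assms]
  using assms by (simp add: ae_rel_def)

lemma measurable_funpow:
  "T \<in> measurable M M \<Longrightarrow> T ^^ k \<in> measurable M M"
proof (induction k)
  case (Suc k)
  then show ?case
    using measurable_comp[OF Suc.IH Suc.prems] by simp
qed simp

text \<open>As the density of \<open>\<mu>\<^sub>1\<close> vanishes off the support of
  \<open>u\<close>, \<open>u\<close> is nonzero almost everywhere for \<open>\<mu>\<^sub>1\<close>,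
  the image of \<open>\<mu>\<close> under \<open>T\<close>. The function \<open>u\<close> itself may
  still vanish on a set of positive \<open>\<mu>\<close>-measure.\<close>

lemma AE_comp_nonzero:
  assumes "sigma_finite_measure M" "nonsingular M T" "u \<in> borel_measurable M"
    and ae: "AE x in M. x \<in> space M - Supp M u \<longrightarrow> pushforward_deriv M T 1 x = 0"
  shows "AE x in M. u (T x) \<noteq> 0"
proof -
  interpret sigma_finite_measure M by fact
  note [measurable] = assms(3)
  have T [measurable]: "T \<in> measurable M M"
    using assms(2) by (simp add: nonsingular_def)
  let ?N = "pushforward_measure M T 1"
  have N: "?N = distr M M T" by (simp add: pushforward_measure_def)
  have "absolutely_continuous M ?N"
    unfolding N using assms(2)
    by (auto simp: absolutely_continuous_def null_sets_def emeasure_distr nonsingular_def)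
  then have dens: "density M (pushforward_deriv M T 1) = ?N"
    unfolding pushforward_deriv_def by (rule density_RN_deriv) (simp add: pushforward_measure_def)
  have meas: "pushforward_deriv M T 1 \<in> borel_measurable M"
    by (simp add: pushforward_deriv_def)
  have "AE x in ?N. u x \<noteq> 0"
    unfolding dens[symmetric] AE_density[OF meas] using ae by (auto simp: Supp_def elim!: AE_mp)
  then show ?thesis
    unfolding N by (subst (asm) AE_distr_iff) auto
qed

text \<open>The weight is the product of \<open>u \<circ> T ^^ j\<close> for \<open>j\<close> from 1
  to \<open>k\<close>. It is kept existential because only its measurability and nonvanishing matter
  for the kernel.\<close>

lemma weighted_composition_funpow:
  assumes ns: "nonsingular M T" and u [measurable]: "u \<in> borel_measurable M"
    and nz: "AE x in M. u (T x) \<noteq> 0" and f [measurable]: "f \<in> borel_measurable M"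
  shows "\<exists>w \<in> borel_measurable M. (AE x in M. w x \<noteq> 0) \<and>
    (weighted_composition M u T ^^ k) (ae_class M f) = ae_class M (\<lambda>x. w x * f ((T ^^ k) x))"
proof (induction k)
  case 0
  show ?case by (rule bexI[of _ "\<lambda>_. 1"]) auto
next
  case (Suc k)
  then obtain w where w [measurable]: "w \<in> borel_measurable M" and w0: "AE x in M. w x \<noteq> 0"
    and eq: "(weighted_composition M u T ^^ k) (ae_class M f) = ae_class M (\<lambda>x. w x * f ((T ^^ k) x))"
    by blast
  have T [measurable]: "T \<in> measurable M M"
    using ns by (simp add: nonsingular_def)
  note [measurable] = measurable_funpow[OF T, of k]
  \<comment> \<open>The additional factor of the operator acts on the outside, so it composes the
    old weight with \<open>T\<close> as well; \<open>funpow_swap1\<close> merges \<open>T\<close>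
    into the iterate inside \<open>f\<close>.\<close>
  have "(weighted_composition M u T ^^ Suc k) (ae_class M f)
      = ae_class M (\<lambda>x. (u (T x) * w (T x)) * f ((T ^^ Suc k) x))"
    using ns by (simp add: eq weighted_composition_ae_class funpow_swap1 mult.assoc)
  moreover have "AE x in M. u (T x) * w (T x) \<noteq> 0"
    using nz nonsingular_AE[OF ns w0] by eventually_elim simp
  ultimately show ?case
    by (intro bexI[of _ "\<lambda>x. u (T x) * w (T x)"]) auto
qed

lemma weighted_composition_funpow_eq_0_iff:
  assumes ns: "nonsingular M T" and u: "u \<in> borel_measurable M"
    and nz: "AE x in M. u (T x) \<noteq> 0" and f [measurable]: "f \<in> borel_measurable M"
  shows "(weighted_composition M u T ^^ k) (ae_class M f) = ae_class M (\<lambda>_. 0)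
    \<longleftrightarrow> (AE x in M. f ((T ^^ k) x) = 0)"
proof -
  obtain w where w [measurable]: "w \<in> borel_measurable M" and w0: "AE x in M. w x \<noteq> 0"
    and eq: "(weighted_composition M u T ^^ k) (ae_class M f) = ae_class M (\<lambda>x. w x * f ((T ^^ k) x))"
    using weighted_composition_funpow[OF assms] by blast
  have [measurable]: "T ^^ k \<in> measurable M M"
    using ns by (intro measurable_funpow) (simp add: nonsingular_def)
  have "(weighted_composition M u T ^^ k) (ae_class M f) = ae_class M (\<lambda>_. 0)
      \<longleftrightarrow> (AE x in M. w x * f ((T ^^ k) x) = 0)"
    unfolding eq by (rule ae_class_eq_iff) auto
  also have "\<dots> \<longleftrightarrow> (AE x in M. f ((T ^^ k) x) = 0)"
    by (rule eventually_subst) (use w0 in eventually_elim, simp)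
  finally show ?thesis .
qed

section \<open>Null sets of the image measures against null spaces\<close>

lemma null_sets_pushforward_iff:
  assumes "T \<in> measurable M M"
  shows "A \<in> null_sets (pushforward_measure M T k)
    \<longleftrightarrow> A \<in> sets M \<and> (AE x in M. (T ^^ k) x \<notin> A)"
proof (cases "A \<in> sets M")
  case True
  have [measurable]: "T ^^ k \<in> measurable M M" by (rule measurable_funpow) fact
  have "A \<in> null_sets (pushforward_measure M T k)
      \<longleftrightarrow> (AE x in pushforward_measure M T k. x \<notin> A)"
    using True by (intro AE_iff_null_sets) (simp add: pushforward_measure_def)
  then show ?thesis
    using True unfolding pushforward_measure_def by (subst (asm) AE_distr_iff) auto
qed (auto simp: pushforward_measure_def)

text \<open>Because \<open>T ^^ (k + 1)\<close> is \<open>T ^^ k\<close> after \<open>T\<close>,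
  non-singularity carries an almost-everywhere statement about \<open>T ^^ k\<close> over to
  \<open>T ^^ (k + 1)\<close>. Equivalence of consecutive measures thus hinges on the reverse
  inclusion of null sets.\<close>

lemma absolutely_continuous_pushforward_Suc:
  assumes "nonsingular M T"
  shows "absolutely_continuous (pushforward_measure M T k) (pushforward_measure M T (k + 1))"
proof -
  have T: "T \<in> measurable M M" using assms by (simp add: nonsingular_def)
  show ?thesis
    unfolding absolutely_continuous_def
  proof
    fix A assume "A \<in> null_sets (pushforward_measure M T k)"
    then have "A \<in> sets M" and "AE x in M. (T ^^ k) x \<notin> A"
      unfolding null_sets_pushforward_iff[OF T] by auto
    from this(1) nonsingular_AE[OF assms this(2)]
    show "A \<in> null_sets (pushforward_measure M T (k + 1))"
      unfolding null_sets_pushforward_iff[OF T] by (simp add: funpow_swap1)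
  qed
qed

lemma lorentz_null_space_eq_iff_equivalent:
  assumes sf: "sigma_finite_measure M" and pq: "lorentz_exponents p q"
    and ns: "nonsingular M T" and u: "u \<in> borel_measurable M"
    and nz: "AE x in M. u (T x) \<noteq> 0"
  shows "lorentz_null_space M p q (weighted_composition M u T ^^ (k + 1))
      = lorentz_null_space M p q (weighted_composition M u T ^^ k)
    \<longleftrightarrow> equivalent_measures (pushforward_measure M T k) (pushforward_measure M T (k + 1))"
    (is "?null (k + 1) = ?null k \<longleftrightarrow> equivalent_measures (?mu k) (?mu (k + 1))")
proof
  interpret sigma_finite_measure M by fact
  have T: "T \<in> measurable M M" using ns by (simp add: nonsingular_def)
  note zero_iff = weighted_composition_funpow_eq_0_iff[OF ns u nz]
  {
    assume eq: "?null (k + 1) = ?null k"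
    \<comment> \<open>Finite measure is what puts the indicator of \<open>A\<close> into the Lorentz
      space, where equality of the null spaces can be applied to it.\<close>
    have fin: "A \<in> null_sets (?mu k)"
      if A: "A \<in> null_sets (?mu (k + 1))" "emeasure M A \<noteq> \<infinity>" for A
    proof -
      have sets: "A \<in> sets M" and ae: "AE x in M. (T ^^ (k + 1)) x \<notin> A"
        using A(1) unfolding null_sets_pushforward_iff[OF T] by auto
      let ?f = "indicator A :: 'a \<Rightarrow> complex"
      have f: "?f \<in> borel_measurable M" using sets by simp
      have "ae_class M ?f \<in> lorentz_space M p q"
        using f lorentz_norm_indicator_finite[OF pq sets] A(2)
        by (auto simp: lorentz_space_def ae_class_def lorentz_functions_def less_top
            intro: quotientI)
      moreover have "AE x in M. ?f ((T ^^ (k + 1)) x) = 0"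
        using ae by eventually_elim simp
      ultimately have "ae_class M ?f \<in> ?null (k + 1)"
        unfolding lorentz_null_space_def using zero_iff[OF f, of "k + 1"] by blast
      then have "ae_class M ?f \<in> ?null k"
        using eq by simp
      then have "AE x in M. ?f ((T ^^ k) x) = 0"
        unfolding lorentz_null_space_def mem_Collect_eq zero_iff[OF f] ..
      then show ?thesis
        unfolding null_sets_pushforward_iff[OF T]
        using sets by (simp add: indicator_eq_0_iff)
    qed
    have "null_sets (?mu (k + 1)) \<subseteq> null_sets (?mu k)"
    proof
      fix A assume A: "A \<in> null_sets (?mu (k + 1))"
      \<comment> \<open>A general null set is cut into countably many pieces of finite
        \<open>\<mu>\<close>-measure, each covered by \<open>fin\<close>.\<close>
      obtain B :: "nat \<Rightarrow> 'a set" where B: "range B \<subseteq> sets M" "(\<Union>i. B i) = space M"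
          "\<And>i. emeasure M (B i) \<noteq> \<infinity>"
        using sigma_finite by blast
      have sets: "A \<in> sets M" using A unfolding null_sets_pushforward_iff[OF T] by auto
      have "A \<inter> B i \<in> null_sets (?mu k)" for i
      proof (rule fin)
        have "B i \<in> sets M" using B(1) by auto
        then show "A \<inter> B i \<in> null_sets (?mu (k + 1))"
          using A by (intro null_set_Int2) (auto simp: pushforward_measure_def)
        have "emeasure M (A \<inter> B i) \<le> emeasure M (B i)"
          using \<open>B i \<in> sets M\<close> by (intro emeasure_mono) auto
        then show "emeasure M (A \<inter> B i) \<noteq> \<infinity>"
          using B(3)[of i] by (auto simp: top_unique)
      qed
      then have "(\<Union>i. A \<inter> B i) \<in> null_sets (?mu k)" by (rule null_sets_UN)
      moreover have "(\<Union>i. A \<inter> B i) = A"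
        using sets.sets_into_space[OF sets] B(2) by blast
      ultimately show "A \<in> null_sets (?mu k)" by simp
    qed
    then show "equivalent_measures (?mu k) (?mu (k + 1))"
      using absolutely_continuous_pushforward_Suc[OF ns]
      by (simp add: equivalent_measures_def absolutely_continuous_def)
  next
    assume "equivalent_measures (?mu k) (?mu (k + 1))"
    then have null: "null_sets (?mu k) = null_sets (?mu (k + 1))"
      by (auto simp: equivalent_measures_def absolutely_continuous_def)
    have "(weighted_composition M u T ^^ (k + 1)) F = ae_class M (\<lambda>_. 0)
        \<longleftrightarrow> (weighted_composition M u T ^^ k) F = ae_class M (\<lambda>_. 0)"
      if "F \<in> lorentz_space M p q" for F
    proof -
      from that obtain f where f: "f \<in> borel_measurable M" and F: "F = ae_class M f"
        by (auto simp: lorentz_space_def lorentz_functions_def ae_class_def elim: quotientE)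
      have [measurable]: "f \<in> borel_measurable M" by (rule f)
      \<comment> \<open>Membership in a null space depends on \<open>f\<close> only through its
        support, so equal null sets give equal null spaces.\<close>
      have "(AE x in M. f ((T ^^ j) x) = 0) \<longleftrightarrow> Supp M f \<in> null_sets (?mu j)" for j
      proof -
        \<comment> \<open>\<open>Supp\<close> is cut down to \<open>space M\<close>, so the iterates
          must be known to stay there.\<close>
        have "AE x in M. (T ^^ j) x \<in> space M"
          using measurable_space[OF measurable_funpow[OF T]] by auto
        then have "(AE x in M. f ((T ^^ j) x) = 0) \<longleftrightarrow> (AE x in M. (T ^^ j) x \<notin> Supp M f)"
          by (intro eventually_subst, eventually_elim) (simp add: Supp_def)
        then show ?thesis
          unfolding null_sets_pushforward_iff[OF T] by (simp add: Supp_def)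
      qed
      then show ?thesis
        unfolding F zero_iff[OF f] using null by blast
    qed
    then show "?null (k + 1) = ?null k"
      unfolding lorentz_null_space_def by blast
  }
qed

text \<open>A finite infimum excludes the empty set, whose infimum is \<open>\<infinity>\<close>; by
  well-ordering the infimum of a nonempty set is attained.\<close>

lemma Inf_enat_image_eq_iff: "Inf (enat ` S) = enat k \<longleftrightarrow> k \<in> S \<and> (\<forall>j\<in>S. k \<le> j)"
proof
  assume eq: "Inf (enat ` S) = enat k"
  then have "S \<noteq> {}" by (auto simp: top_enat_def)
  then have "Inf (enat ` S) \<in> enat ` S"
    unfolding Inf_enat_def by (auto intro: LeastI)
  moreover have "enat k \<le> enat j" if "j \<in> S" for j
    unfolding eq[symmetric] using that by (intro Inf_lower) auto
  ultimately show "k \<in> S \<and> (\<forall>j\<in>S. k \<le> j)"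
    unfolding eq by auto
next
  assume "k \<in> S \<and> (\<forall>j\<in>S. k \<le> j)"
  then show "Inf (enat ` S) = enat k"
    by (intro antisym Inf_lower Inf_greatest) auto
qed

theorem theorem4p6:
  fixes M :: "'a measure" and T :: "'a \<Rightarrow> 'a" and u :: "'a \<Rightarrow> complex"
    and p q :: ennreal and k :: nat
  assumes "sigma_finite_measure M" and "complete_measure M"
    and "lorentz_exponents p q"
    and "nonsingular M T"
    and "u \<in> borel_measurable M" and "\<not> (AE x in M. u x = 0)"
    and "bounded_on_lorentz M p q (weighted_composition M u T)"
    and "essentially_bounded M u"
    and "AE x in M. x \<in> space M - Supp M u \<longrightarrow> pushforward_deriv M T 1 x = 0"
  shows "ascent M p q (weighted_composition M u T) = enat k \<longleftrightarrow>
    (equivalent_measures (pushforward_measure M T k) (pushforward_measure M T (k + 1)) \<and>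
     (\<forall>j. equivalent_measures (pushforward_measure M T j) (pushforward_measure M T (j + 1)) \<longrightarrow> k \<le> j))"
  \<comment> \<open>The indices at which the null spaces stabilise are exactly those at which
    consecutive measures are equivalent, so both sides describe the least element of one
    set.\<close>
  unfolding ascent_def Inf_enat_image_eq_iff
    lorentz_null_space_eq_iff_equivalent[OF assms(1,3,4,5) AE_comp_nonzero[OF assms(1,4,5,9)]]
  by blast

end
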